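(* Let $(a_i)_{i\in\mathbb{Z}}$ be a sequence of integers with $a_i\geq 2$ for all $i$, let $\lambda=(\lambda_1,\dots,\lambda_h)$ be a partition with conjugate $\lambda'=(\lambda'_1,\dots,\lambda'_{\lambda_1})$, and let $\mathbf{k}=(\lambda,(k_{i,j}))$ be the Young tableau of shape $\lambda$ with $k_{i,j}=a_{j-i}$ for $(i,j)\in D(\lambda)$. Then $$\zeta^t(\mathbf{k})=\det\Big(\zeta^t\big(a_{j-1},a_{j-2},\dots,a_{j-(\lambda'_i+j-i)}\big)\Big)_{1\leq i,j\leq\lambda_1},$$ where the $(i,j)$ entry $\zeta^t(a_{j-1},a_{j-2},\dots,a_{j-(\lambda'_i+j-i)})$ (which has $\lambda'_i+j-i$ arguments) is set to be $1$ if $\lambda'_i-i+j=0$ and $0$ if $\lambda'_i-i+j<0$.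
   Context: A partition is a tuple $\lambda=(\lambda_1,\dots,\lambda_h)$ of integers with $\lambda_1\geq\dots\geq\lambda_h\geq 1$. Its conjugate $\lambda'=(\lambda'_1,\dots,\lambda'_{\lambda_1})$ is obtained by transposing the Young diagram, i.e. $\lambda'_j=\#\{i\mid \lambda_i\geq j\}$. Put $D(\lambda)=\{(i,j)\in\mathbb{Z}^2\mid 1\leq i\leq h,\ 1\leq j\leq\lambda_i\}$. A Young tableau of shape $\lambda$ is a tuple $\mathbf{k}=(\lambda,(k_{i,j}))$ with arbitrary integers $k_{i,j}$ for $(i,j)\in D(\lambda)$. For $N\geq 1$, $\mathrm{OYT}_N(\lambda)$ is the set of Young tableaux $\mathbf{m}=(\lambda,(m_{i,j}))$ with $0<m_{i,j}<N$ for all cells and $m_{i,j}\leq m_{i+1,j}$, $m_{i,j}\leq m_{i,j+1}$, $m_{i,j}<m_{i+1,j+1}$ whenever the cells involved lie in $D(\lambda)$. Let $v(\mathbf{m})$ be the number of $(i,j)\in D(\lambda)$ with $(i+1,j)\in D(\lambda)$ and $m_{i,j}=m_{i+1,j}$, and let $h(\mathbf{m})$ be the number of $(i,j)\in D(\lambda)$ with $(i,j+1)\in D(\lambda)$ and $m_{i,j}=m_{i,j+1}$. Define $$\zeta_N^t(\mathbf{k})=\sum_{\mathbf{m}=(\lambda,(m_{i,j}))\in\mathrm{OYT}_N(\lambda)}t^{v(\mathbf{m})}(1-t)^{h(\mathbf{m})}\prod_{(i,j)\in D(\lambda)}\frac{1}{m_{i,j}^{k_{i,j}}}\in\mathbb{Q}[t],$$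 and $\zeta^t(\mathbf{k})=\lim_{N\to\infty}\zeta^t_N(\mathbf{k})\in\mathbb{R}[t]$ (coefficientwise limit in the polynomial variable $t$), which exists whenever all $k_{i,j}\geq1$ and $k_{i,j}\geq 2$ at every corner, i.e. every $(i,j)\in D(\lambda)$ with $(i+1,j),(i,j+1)\notin D(\lambda)$; in particular whenever all $k_{i,j}\geq 2$. For integers $k_1,\dots,k_{r-1}\geq 1$, $k_r\geq 2$, the interpolated multiple zeta value is $$\zeta^t(k_1,\dots,k_r)=\sum_{0<m_1\leq\dots\leq m_r}\frac{t^{e(m_1,\dots,m_r)}}{m_1^{k_1}\cdots m_r^{k_r}}\in\mathbb{R}[t],\qquad e(m_1,\dots,m_r)=\#\{1\leq i\leq r-1\mid m_i=m_{i+1}\}.$$ *)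

theory Defs
  imports
    Complex_Main
    "HOL-Library.FuncSet"
    "HOL-Analysis.Infinite_Sum"
    "HOL-Computational_Algebra.Polynomial"
    "Jordan_Normal_Form.Determinant"
begin

text \<open>A partition is the list of its parts. The empty partition is allowed.
  Rows and columns are counted from 1, list positions from 0.\<close>

definition is_partition :: "nat list \<Rightarrow> bool" where
  "is_partition lam \<longleftrightarrow> sorted_wrt (\<ge>) lam \<and> (\<forall>p\<in>set lam. 1 \<le> p)"

definition diagram :: "nat list \<Rightarrow> (nat \<times> nat) set" where
  "diagram lam = {(i, j). 1 \<le> i \<and> i \<le> length lam \<and> 1 \<le> j \<and> j \<le> lam ! (i - 1)}"

definition first_part :: "nat list \<Rightarrow> nat" where
  "first_part lam = (if lam = [] then 0 else hd lam)"

definition conjugate_part :: "nat list \<Rightarrow> nat \<Rightarrow> nat" where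
  "conjugate_part lam j = card {i. 1 \<le> i \<and> i \<le> length lam \<and> j \<le> lam ! (i - 1)}"

definition coeffwise_LIMSEQ :: "(nat \<Rightarrow> real poly) \<Rightarrow> real poly \<Rightarrow> bool" where
  "coeffwise_LIMSEQ f p \<longleftrightarrow> (\<forall>n. (\<lambda>N. coeff (f N) n) \<longlonglongrightarrow> coeff p n)"

definition coeffwise_has_sum :: "('a \<Rightarrow> real poly) \<Rightarrow> 'a set \<Rightarrow> real poly \<Rightarrow> bool" where
  "coeffwise_has_sum f A p \<longleftrightarrow> (\<forall>n. ((\<lambda>x. coeff (f x) n) has_sum coeff p n) A)"

lemma coeffwise_LIMSEQ_unique:
  "coeffwise_LIMSEQ f p \<Longrightarrow> coeffwise_LIMSEQ f q \<Longrightarrow> p = q"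
  unfolding coeffwise_LIMSEQ_def by (intro poly_eqI) (blast intro: LIMSEQ_unique)

lemma coeffwise_has_sum_unique:
  "coeffwise_has_sum f A p \<Longrightarrow> coeffwise_has_sum f A q \<Longrightarrow> p = q"
  unfolding coeffwise_has_sum_def by (intro poly_eqI) (blast intro: has_sum_unique)

text \<open>A filling of the diagram is a function on cells that is \<^const>\<open>undefined\<close> outside
  the diagram, so that fillings are determined by their entries.\<close>

definition OYT :: "nat \<Rightarrow> nat list \<Rightarrow> (nat \<times> nat \<Rightarrow> nat) set" where
  "OYT N lam = {m \<in> diagram lam \<rightarrow>\<^sub>E {0<..<N}.
     (\<forall>i j. (i, j) \<in> diagram lam \<and> (i + 1, j) \<in> diagram lam \<longrightarrow> m (i, j) \<le> m (i + 1, j)) \<and>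
     (\<forall>i j. (i, j) \<in> diagram lam \<and> (i, j + 1) \<in> diagram lam \<longrightarrow> m (i, j) \<le> m (i, j + 1)) \<and>
     (\<forall>i j. (i, j) \<in> diagram lam \<and> (i + 1, j + 1) \<in> diagram lam \<longrightarrow>
        m (i, j) < m (i + 1, j + 1))}"

definition vert_eq :: "nat list \<Rightarrow> (nat \<times> nat \<Rightarrow> nat) \<Rightarrow> nat" where
  "vert_eq lam m =
     card {(i, j). (i, j) \<in> diagram lam \<and> (i + 1, j) \<in> diagram lam \<and> m (i, j) = m (i + 1, j)}"

definition horiz_eq :: "nat list \<Rightarrow> (nat \<times> nat \<Rightarrow> nat) \<Rightarrow> nat" where
  "horiz_eq lam m =
     card {(i, j). (i, j) \<in> diagram lam \<and> (i, j + 1) \<in> diagram lam \<and> m (i, j) = m (i, j + 1)}"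

text \<open>The variable \<open>t\<close> is \<open>[:0, 1:]\<close>, and \<open>1 - t\<close> is \<open>[:1, -1:]\<close>.
  The truncated sum, whose coefficients are rational, is taken directly in the polynomials over
  the reals. A tableau of shape \<open>lam\<close> is a function \<open>k\<close> of which only the values
  on the diagram are used.\<close>

definition tableau_zeta_trunc :: "nat \<Rightarrow> nat list \<Rightarrow> (nat \<times> nat \<Rightarrow> int) \<Rightarrow> real poly" where
  "tableau_zeta_trunc N lam k =
     (\<Sum>m\<in>OYT N lam. smult (\<Prod>c\<in>diagram lam. 1 / real (m c) powi k c)
        ([:0, 1:] ^ vert_eq lam m * [:1, -1:] ^ horiz_eq lam m))"

definition tableau_zeta :: "nat list \<Rightarrow> (nat \<times> nat \<Rightarrow> int) \<Rightarrow> real poly" where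
  "tableau_zeta lam k = (THE p. coeffwise_LIMSEQ (\<lambda>N. tableau_zeta_trunc N lam k) p)"

definition num_eq :: "nat list \<Rightarrow> nat" where
  "num_eq ms = card {i. Suc i < length ms \<and> ms ! i = ms ! Suc i}"

definition interp_mzv :: "int list \<Rightarrow> real poly" where
  "interp_mzv ks = (THE p. coeffwise_has_sum
     (\<lambda>ms. smult (1 / (\<Prod>i<length ks. real (ms ! i) powi (ks ! i))) ([:0, 1:] ^ num_eq ms))
     {ms :: nat list. length ms = length ks \<and> sorted ms \<and> (\<forall>m\<in>set ms. 0 < m)} p)"

text \<open>The \<open>(i, j)\<close> entry of the determinant, for \<open>i\<close> and \<open>j\<close> counted from 1.\<close>

definition jt_entry :: "nat list \<Rightarrow> (int \<Rightarrow> int) \<Rightarrow> nat \<Rightarrow> nat \<Rightarrow> real poly" where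
  "jt_entry lam a i j =
     (let r = int (conjugate_part lam i) + int j - int i in
      if r < 0 then 0
      else if r = 0 then 1
      else interp_mzv (map (\<lambda>s. a (int j - s)) [1..r]))"

end

theory Submission
  imports Defs "HOL-Analysis.Summation_Tests"
begin

text \<open>The identity holds for the truncated sums, in any commutative ring and for arbitrary weights
  attached to a value and a content. Let \<open>H\<^sub>N p j\<close> be the sum over chains of entries below \<open>N\<close> that
  carry the contents \<open>j - 1, \<dots>, p\<close>, and describe a shape by the contents \<open>p 1 < p 2 < \<dots>\<close> of the
  bottom cells of its columns, so that row \<open>i\<close> of the matrix is \<open>H\<^sub>N (p i)\<close>. Allowing the entry \<open>N\<close>
  gives \<open>H\<^sub>N\<^sub>+\<^sub>1 p = H\<^sub>N p + x ((1 - t) H\<^sub>N (p + 1) + t H\<^sub>N\<^sub>+\<^sub>1 (p + 1))\<close>, where \<open>x\<close> is the weight of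
  \<open>N\<close> at content \<open>p\<close>. Iterating from \<open>p i\<close> up to \<open>p (i + 1)\<close> writes row \<open>i\<close> for \<open>N + 1\<close> as a
  combination of rows \<open>H\<^sub>N q\<close> with \<open>p i \<le> q \<le> p (i + 1)\<close>, modulo row \<open>i + 1\<close> for \<open>N + 1\<close>.
  Expanding the determinant multilinearly, the coefficients are exactly the weights of the cells
  with entry \<open>N\<close> in a tableau: these cells form a skew shape without \<open>2 \<times> 2\<close> squares, and the
  only horizontal equality between columns \<open>i\<close> and \<open>i + 1\<close> occurs when \<open>q = p (i + 1)\<close>. Hence both
  sides satisfy the same recursion in \<open>N\<close>.\<close>

section \<open>Chains\<close>

definition seqs :: "nat \<Rightarrow> nat \<Rightarrow> nat list set" where
  "seqs N r = {ms. length ms = r \<and> sorted ms \<and> set ms \<subseteq> {0<..<N}}"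

lemma finite_seqs [simp]: "finite (seqs N r)"
  by (rule finite_subset [OF _ finite_lists_length_eq [of "{0<..<N}" r]]) (auto simp: seqs_def)

lemma seqs_0 [simp]: "seqs N 0 = {[]}"
  by (auto simp: seqs_def)

lemma seqs_mono: "seqs N r \<subseteq> seqs (Suc N) r"
  by (force simp: seqs_def)

text \<open>Split by whether the last, hence largest, entry is \<open>N\<close>. The entries before
  a final \<open>N\<close> may again equal \<open>N\<close>.\<close>

lemma seqs_Suc_Suc:
  assumes "0 < N"
  shows "seqs (Suc N) (Suc r) = seqs N (Suc r) \<union> (\<lambda>ms. ms @ [N]) ` seqs (Suc N) r"
proof (intro equalityI subsetI)
  fix ms assume ms: "ms \<in> seqs (Suc N) (Suc r)"
  then obtain ms' m where eq: "ms = ms' @ [m]"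
    by (cases ms rule: rev_cases) (auto simp: seqs_def)
  have "m \<le> N" "\<forall>y\<in>set ms'. y \<le> m"
    using ms by (auto simp: seqs_def eq sorted_append)
  then show "ms \<in> seqs N (Suc r) \<union> (\<lambda>ms. ms @ [N]) ` seqs (Suc N) r"
    using ms by (cases "m = N") (fastforce simp: seqs_def eq sorted_append)+
qed (use assms in \<open>fastforce simp: seqs_def sorted_append\<close>)+

lemma num_eq_snoc:
  "num_eq (ms @ [n]) = num_eq ms + (if ms \<noteq> [] \<and> last ms = n then 1 else 0)"
proof -
  let ?A = "{i. Suc i < length ms \<and> ms ! i = ms ! Suc i}"
  let ?B = "if ms \<noteq> [] \<and> last ms = n then {length ms - 1} else {}"
  have "{i. Suc i < length (ms @ [n]) \<and> (ms @ [n]) ! i = (ms @ [n]) ! Suc i} = ?A \<union> ?B"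
  proof -
    have "ms ! i = last ms" if "i < length ms" "\<not> Suc i < length ms" for i
      using that by (subst last_conv_nth) (auto intro: arg_cong [of _ _ "nth ms"])
    then show ?thesis
      by (cases ms rule: rev_cases) (auto simp: nth_append less_Suc_eq)
  qed
  moreover have "card (?A \<union> ?B) = card ?A + card ?B"
    by (rule card_Un_disjoint) (auto intro: finite_subset [of _ "{..length ms}"])
  ultimately show ?thesis
    by (simp add: num_eq_def)
qed

text \<open>A sorted chain with entries up to \<open>N\<close> contains \<open>N\<close> exactly
  when it ends in \<open>N\<close>; only then does appending \<open>N\<close> create an
  equality.\<close>

lemma num_eq_snoc_seqs:
  assumes "ms \<in> seqs (Suc N) r"
  shows "num_eq (ms @ [N]) = num_eq ms + (if ms \<in> seqs N r then 0 else 1)"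
proof -
  have "ms \<in> seqs N r \<longleftrightarrow> \<not> (ms \<noteq> [] \<and> last ms = N)"
    using assms by (cases ms rule: rev_cases) (fastforce simp: seqs_def sorted_append)+
  then show ?thesis
    by (simp add: num_eq_snoc)
qed

text \<open>The content of the \<open>i\<close>-th entry is \<open>j - 1 - i\<close>, so the largest entry has content \<open>p\<close>.\<close>

definition chain_sum :: "(nat \<Rightarrow> int \<Rightarrow> 'a::comm_ring_1) \<Rightarrow> 'a \<Rightarrow> nat \<Rightarrow> int \<Rightarrow> int \<Rightarrow> 'a" where
  "chain_sum x t N p j = (if j < p then 0 else
     \<Sum>ms\<in>seqs N (nat (j - p)). t ^ num_eq ms * (\<Prod>i<nat (j - p). x (ms ! i) (j - 1 - int i)))"

lemma chain_sum_eq_0 [simp]: "j < p \<Longrightarrow> chain_sum x t N p j = 0"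
  by (simp add: chain_sum_def)

lemma chain_sum_refl [simp]: "chain_sum x t N j j = 1"
  by (simp add: chain_sum_def num_eq_def)

text \<open>In a chain ending in \<open>N\<close>, the last step costs 1 if the rest avoids
  \<open>N\<close> and \<open>t\<close> otherwise, which gives
  \<open>H\<^sub>N + t (H\<^sub>N\<^sub>+\<^sub>1 - H\<^sub>N)\<close> at \<open>p + 1\<close>. For
  \<open>j \<le> p\<close> the bracket vanishes.\<close>

lemma chain_sum_step:
  assumes "0 < N"
  shows "chain_sum x t (Suc N) p j = chain_sum x t N p j +
    x N p * ((1 - t) * chain_sum x t N (p + 1) j + t * chain_sum x t (Suc N) (p + 1) j)"
proof (cases "p < j")
  case True
  define r where "r = nat (j - (p + 1))"
  have r: "nat (j - p) = Suc r" "j - 1 - int r = p"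
    using True by (auto simp: r_def)
  define g where "g = (\<lambda>ms. t ^ num_eq ms * (\<Prod>i<r. x (ms ! i) (j - 1 - int i)))"
  define f where "f = (\<lambda>ms. t ^ num_eq ms * (\<Prod>i<Suc r. x (ms ! i) (j - 1 - int i)))"
  have H: "chain_sum x t M p j = sum f (seqs M (Suc r))"
    "chain_sum x t M (p + 1) j = sum g (seqs M r)" for M
    using True by (simp_all add: chain_sum_def r f_def g_def r_def[symmetric] del: prod.lessThan_Suc)
  have f_snoc: "f (ms @ [N]) = x N p * (if ms \<in> seqs N r then g ms else t * g ms)"
    if ms: "ms \<in> seqs (Suc N) r" for ms
  proof -
    have len: "length ms = r" using ms by (simp add: seqs_def)
    then have "(\<Prod>i<r. x ((ms @ [N]) ! i) (j - 1 - int i)) = (\<Prod>i<r. x (ms ! i) (j - 1 - int i))"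
      by (intro prod.cong) (auto simp: nth_append)
    moreover have "(ms @ [N]) ! r = N"
      using len by (metis nth_append_length)
    ultimately show ?thesis
      by (simp add: f_def g_def num_eq_snoc_seqs [OF ms] r)
  qed
  have "sum f (seqs (Suc N) (Suc r)) = sum f (seqs N (Suc r)) + (\<Sum>ms\<in>seqs (Suc N) r. f (ms @ [N]))"
  proof -
    have "seqs N (Suc r) \<inter> (\<lambda>ms. ms @ [N]) ` seqs (Suc N) r = {}"
      by (auto simp: seqs_def)
    moreover have "inj_on (\<lambda>ms. ms @ [N]) (seqs (Suc N) r)"
      by (auto simp: inj_on_def)
    ultimately show ?thesis
      by (simp add: seqs_Suc_Suc [OF assms] sum.union_disjoint sum.reindex)
  qed
  also have "(\<Sum>ms\<in>seqs (Suc N) r. f (ms @ [N])) =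
      (\<Sum>ms\<in>seqs (Suc N) r. x N p * (if ms \<in> seqs N r then g ms else t * g ms))"
    by (simp add: f_snoc)
  also have "\<dots> = x N p * ((\<Sum>ms\<in>seqs N r. g ms) + (\<Sum>ms\<in>seqs (Suc N) r - seqs N r. t * g ms))"
    using seqs_mono [of N r]
    by (simp add: sum_distrib_left sum.If_cases Int_absorb1 Diff_eq distrib_left if_distrib)
  also have "(\<Sum>ms\<in>seqs (Suc N) r - seqs N r. t * g ms) = t * (sum g (seqs (Suc N) r) - sum g (seqs N r))"
    by (simp add: sum_distrib_left [symmetric] sum_diff seqs_mono)
  finally show ?thesis
    unfolding H by (simp add: algebra_simps)
next
  case False
  then show ?thesis
    by (cases "p = j") auto
qed

text \<open>Weight of the entries \<open>N\<close> in one column, which fill the contents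
  \<open>p, ..., q - 1\<close> from the bottom: one \<open>t\<close> per vertical equality, and
  \<open>1 - t\<close> if the top one has a right neighbour, namely the bottom cell of the next
  column, of content \<open>p'\<close>.\<close>

definition strip_weight :: "(nat \<Rightarrow> int \<Rightarrow> 'a::comm_ring_1) \<Rightarrow> 'a \<Rightarrow> nat \<Rightarrow> int \<Rightarrow> int \<Rightarrow> int \<Rightarrow> 'a" where
  "strip_weight x t N p p' q =
     t ^ nat (q - p - 1) * (\<Prod>s=p..<q. x N s) * (if q = p' then 1 - t else 1)"

text \<open>\<open>chain_sum_step\<close> is substituted repeatedly into its own last term until
  \<open>p'\<close> is reached; the remainder is a multiple of the next matrix row for
  \<open>Suc N\<close>.\<close>

lemma chain_sum_strip:
  assumes "0 < N" "p < p'"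
  shows "chain_sum x t (Suc N) p j =
    (\<Sum>q=p..p'. strip_weight x t N p p' q * chain_sum x t N q j) +
    t ^ nat (p' - p) * (\<Prod>s=p..<p'. x N s) * chain_sum x t (Suc N) p' j"
proof -
  define X where "X q = t ^ nat (q - p - 1) * (\<Prod>s=p..<q. x N s)" for q
  let ?H = "\<lambda>q. chain_sum x t N q j" and ?H' = "\<lambda>q. chain_sum x t (Suc N) q j"
  have XS: "X (p' + 1) = t * x N p' * X p'" if "p < p'" for p'
  proof -
    have "{p..<p' + 1} = insert p' {p..<p'}" using that by auto
    moreover have "nat (p' + 1 - p - 1) = Suc (nat (p' - p - 1))" using that by auto
    ultimately show ?thesis by (simp add: X_def algebra_simps)
  qed
  have "?H' p = (\<Sum>q=p..<p'. X q * ?H q) + X p' * ((1 - t) * ?H p' + t * ?H' p')"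
    using \<open>p < p'\<close>
  proof (induction p' rule: int_gr_induct)
    case base
    have "{p..<p + 1} = {p}" by auto
    then show ?case using chain_sum_step [OF assms(1), of x t p j] by (simp add: X_def)
  next
    case (step p')
    have "{p..<p' + 1} = insert p' {p..<p'}" using step by auto
    \<comment> \<open>Unfolding \<open>?H'\<close> merges \<open>(1 - t) * ?H p'\<close> with
      \<open>t * ?H p'\<close>, so \<open>1 - t\<close> survives only at the final content.\<close>
    moreover have E: "(1 - t) * ?H p' + t * ?H' p' =
        ?H p' + t * (x N p' * ((1 - t) * ?H (p' + 1) + t * ?H' (p' + 1)))"
      by (simp add: chain_sum_step [OF assms(1), of x t p'] algebra_simps)
    ultimately show ?case
      unfolding step(2) E XS [OF step(1)] by (simp add: algebra_simps)
  qed
  moreover have "{p..p'} = insert p' {p..<p'}" using \<open>p < p'\<close> by auto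
  moreover have "t ^ nat (p' - p) = t * t ^ nat (p' - p - 1)"
    using \<open>p < p'\<close> by (simp flip: power_Suc add: Suc_nat_eq_nat_zadd1)
  moreover have "(\<Sum>q=p..<p'. strip_weight x t N p p' q * ?H q) = (\<Sum>q=p..<p'. X q * ?H q)"
    by (intro sum.cong) (auto simp: strip_weight_def X_def)
  ultimately show ?thesis
    by (simp add: strip_weight_def X_def algebra_simps)
qed

section \<open>Determinants of chain sums\<close>

definition chain_det :: "(nat \<Rightarrow> int \<Rightarrow> 'a::comm_ring_1) \<Rightarrow> 'a \<Rightarrow> nat \<Rightarrow> nat \<Rightarrow> (nat \<Rightarrow> int) \<Rightarrow> 'a" where
  "chain_det x t N n p = Determinant.det (Matrix.mat n n
     (\<lambda>(i, j). chain_sum x t N (p (i + 1)) (int (j + 1))))"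

text \<open>Past the last column the next content is that of an empty column \<open>n + 1\<close>, whose chain sums
  up to column \<open>n\<close> vanish.\<close>

definition next_content :: "nat \<Rightarrow> (nat \<Rightarrow> int) \<Rightarrow> nat \<Rightarrow> int" where
  "next_content n p j = (if j = n then int n + 1 else p (j + 1))"

text \<open>The function \<open>p\<close> gives the content of the bottom cell of each of the \<open>n\<close> columns, so column
  \<open>j\<close> has \<open>j - p j\<close> cells. Empty columns are allowed.\<close>

definition shape :: "nat \<Rightarrow> (nat \<Rightarrow> int) \<Rightarrow> bool" where
  "shape n p \<longleftrightarrow> (\<forall>j\<in>{1..n}. p j < next_content n p j)"

section \<open>Multilinearity and row operations for determinants\<close>

text \<open>In every Leibniz term the product of row sums expands over choice functions
  \<open>g\<close>; the coefficients \<open>w\<close> are independent of the permutation and factor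
  out.\<close>

lemma det_rows_sum:
  fixes f :: "'b \<Rightarrow> nat \<Rightarrow> 'a::comm_ring_1"
  assumes "\<And>i. i \<in> {1..n} \<Longrightarrow> finite (B i)"
  shows "Determinant.det (Matrix.mat n n (\<lambda>(i, j). \<Sum>q\<in>B (i + 1). w (i + 1) q * f q (j + 1))) =
    (\<Sum>g\<in>PiE {1..n} B. (\<Prod>i=1..n. w i (g i)) *
      Determinant.det (Matrix.mat n n (\<lambda>(i, j). f (g (i + 1)) (j + 1))))"
proof -
  let ?P = "{\<pi>. \<pi> permutes {0..<n}}"
  have shift: "(\<Prod>i=0..<n. F (i + 1)) = (\<Prod>i=1..n. F i)" for F :: "nat \<Rightarrow> 'a"
    by (rule prod.reindex_bij_witness [of _ "\<lambda>i. i - 1" "\<lambda>i. i + 1"]) auto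
  have "(\<Prod>i=0..<n. \<Sum>q\<in>B (i + 1). w (i + 1) q * f q (\<pi> i + 1)) =
      (\<Sum>g\<in>PiE {1..n} B. (\<Prod>i=1..n. w i (g i)) * (\<Prod>i=0..<n. f (g (i + 1)) (\<pi> i + 1)))" for \<pi>
  proof -
    have "(\<Prod>i=0..<n. \<Sum>q\<in>B (i + 1). w (i + 1) q * f q (\<pi> i + 1)) =
        (\<Prod>i=1..n. \<Sum>q\<in>B i. w i q * f q (\<pi> (i - 1) + 1))"
      by (subst shift [symmetric]) simp
    also have "\<dots> = (\<Sum>g\<in>PiE {1..n} B. \<Prod>i=1..n. w i (g i) * f (g i) (\<pi> (i - 1) + 1))"
      by (rule prod_sum_PiE) (use assms in auto)
    also have "\<dots> = (\<Sum>g\<in>PiE {1..n} B. (\<Prod>i=1..n. w i (g i)) * (\<Prod>i=0..<n. f (g (i + 1)) (\<pi> i + 1)))"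
    proof (rule sum.cong [OF refl])
      fix g :: "nat \<Rightarrow> 'b"
      show "(\<Prod>i=1..n. w i (g i) * f (g i) (\<pi> (i - 1) + 1)) =
          (\<Prod>i=1..n. w i (g i)) * (\<Prod>i=0..<n. f (g (i + 1)) (\<pi> i + 1))"
        using shift [of "\<lambda>i. f (g i) (\<pi> (i - 1) + 1)"] by (simp add: prod.distrib)
    qed
    finally show ?thesis .
  qed
  then show ?thesis
    by (subst (1 2) Determinant.det_def)
      (simp add: sum_distrib_left sum.swap [of _ ?P] ac_simps)
qed

lemma det_row_eq_0:
  fixes A :: "'a::comm_ring_1 mat"
  assumes "A \<in> carrier_mat n n" "i < n" "\<And>j. j < n \<Longrightarrow> A $$ (i, j) = 0"
  shows "Determinant.det A = 0"
  using assms by (subst laplace_expansion_row [of A n i]) auto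

text \<open>\<open>B\<close> is \<open>A\<close> multiplied from the left by a bidiagonal matrix
  with unit diagonal. Each row is corrected by a row of \<open>A\<close> itself, so one matrix
  handles all rows.\<close>

lemma det_row_shear:
  fixes A B :: "'a::comm_ring_1 mat"
  assumes A: "A \<in> carrier_mat n n" and B: "B \<in> carrier_mat n n"
    and eq: "\<And>i j. i < n \<Longrightarrow> j < n \<Longrightarrow>
      A $$ (i, j) = B $$ (i, j) + (if Suc i < n then c i * A $$ (Suc i, j) else 0)"
  shows "Determinant.det A = Determinant.det B"
proof -
  define L where "L = Matrix.mat n n (\<lambda>(i, k). if k = i then 1 else if k = Suc i then - c i else 0)"
  have L: "L \<in> carrier_mat n n" by (simp add: L_def)
  have "B = L * A"
  proof (rule eq_matI)
    fix i j assume "i < dim_row (L * A)" "j < dim_col (L * A)"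
    then have ij: "i < n" "j < n" using A L by auto
    have "(L * A) $$ (i, j) = (\<Sum>k=0..<n. (if k = i then A $$ (k, j) else 0) +
        (if k = Suc i then - c i * A $$ (k, j) else 0))"
      using ij A L by (auto simp: L_def scalar_prod_def intro!: sum.cong)
    also have "\<dots> = A $$ (i, j) + (if Suc i < n then - c i * A $$ (Suc i, j) else 0)"
      using ij by (simp add: sum.distrib)
    also have "\<dots> = B $$ (i, j)"
      using eq [OF ij] by simp
    finally show "B $$ (i, j) = (L * A) $$ (i, j)" by simp
  qed (use A B L in auto)
  moreover have "Determinant.det L = 1"
  proof -
    have "diag_mat L = replicate n 1"
      by (simp add: diag_mat_def L_def list_eq_iff_nth_eq)
    then show ?thesis
      by (subst det_upper_triangular [OF _ L]) (auto simp: upper_triangular_def L_def)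
  qed
  ultimately show ?thesis
    using det_mult [OF L A] by simp
qed

text \<open>If \<open>q\<close> fails to increase, two adjacent rows coincide or the last row vanishes.\<close>

lemma chain_det_not_shape:
  assumes q: "q \<in> PiE {1..n} (\<lambda>j. {p j..next_content n p j})" and "\<not> shape n q"
  shows "chain_det x t N n q = 0"
proof -
  define M where "M = Matrix.mat n n (\<lambda>(i, j). chain_sum x t N (q (i + 1)) (int (j + 1)))"
  have M: "M \<in> carrier_mat n n" by (simp add: M_def)
  obtain j where j: "j \<in> {1..n}" "next_content n q j \<le> q j"
    using assms(2) by (force simp: shape_def)
  have "Determinant.det M = 0"
  proof (cases "j = n")
    case True
    then show ?thesis
      using j by (intro det_row_eq_0 [OF M, of "n - 1"]) (auto simp: M_def next_content_def)
  next
    case False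
    then have "j + 1 \<in> {1..n}" using j by auto
    \<comment> \<open>The bounds give \<open>q j \<le> p (j + 1) \<le> q (j + 1)\<close>; the
      failure at \<open>j\<close> gives the reverse inequality.\<close>
    then have "q j = q (j + 1)"
      using PiE_mem [OF q, of j] PiE_mem [OF q, of "j + 1"] j False by (auto simp: next_content_def)
    then show ?thesis
      using j False M by (intro det_identical_rows [OF M, of "j - 1" j]) (auto simp: M_def)
  qed
  then show ?thesis
    by (simp add: chain_det_def M_def)
qed

text \<open>Row shears remove the \<open>Suc N\<close> terms of \<open>chain_sum_strip\<close>,
  multilinearity expands the rest, and choices that are not shapes contribute nothing.\<close>

lemma chain_det_step:
  assumes "0 < N" "shape n p"
  shows "chain_det x t (Suc N) n p =
    (\<Sum>q | q \<in> PiE {1..n} (\<lambda>j. {p j..next_content n p j}) \<and> shape n q.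
      (\<Prod>j=1..n. strip_weight x t N (p j) (next_content n p j) (q j)) * chain_det x t N n q)"
proof -
  let ?w = "\<lambda>j. strip_weight x t N (p j) (next_content n p j)"
  define A where "A = Matrix.mat n n (\<lambda>(i, j). chain_sum x t (Suc N) (p (i + 1)) (int (j + 1)))"
  define B where "B = Matrix.mat n n (\<lambda>(i, j). \<Sum>q\<in>{p (i + 1)..next_content n p (i + 1)}.
    ?w (i + 1) q * chain_sum x t N q (int (j + 1)))"
  define c where "c i = t ^ nat (next_content n p (i + 1) - p (i + 1)) *
    (\<Prod>s=p (i + 1)..<next_content n p (i + 1). x N s)" for i
  have "Determinant.det A = Determinant.det B"
  proof (rule det_row_shear)
    fix i j assume ij: "i < n" "j < n"
    then have "p (i + 1) < next_content n p (i + 1)"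
      using assms(2) by (simp add: shape_def)
    \<comment> \<open>In the last row the correction starts at content \<open>n + 1\<close>, beyond
      every column, so it vanishes.\<close>
    from chain_sum_strip [OF assms(1) this, of x t "int (j + 1)"] ij
    show "A $$ (i, j) = B $$ (i, j) + (if Suc i < n then c i * A $$ (Suc i, j) else 0)"
      by (auto simp: A_def B_def c_def next_content_def)
  qed (auto simp: A_def B_def)
  also have "\<dots> = (\<Sum>q\<in>PiE {1..n} (\<lambda>j. {p j..next_content n p j}).
      (\<Prod>j=1..n. ?w j (q j)) * chain_det x t N n q)"
    unfolding B_def chain_det_def
    by (rule det_rows_sum [of n "\<lambda>j. {p j..next_content n p j}" ?w "\<lambda>q j. chain_sum x t N q (int j)"]) auto
  also have "\<dots> = (\<Sum>q | q \<in> PiE {1..n} (\<lambda>j. {p j..next_content n p j}) \<and> shape n q.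
      (\<Prod>j=1..n. ?w j (q j)) * chain_det x t N n q)"
    by (rule sum.mono_neutral_right)
      (auto intro!: finite_PiE simp: chain_det_not_shape [where n = n and p = p, simplified])
  finally show ?thesis
    by (simp add: chain_det_def A_def)
qed

section \<open>Tableaux\<close>

definition cells :: "nat \<Rightarrow> (nat \<Rightarrow> int) \<Rightarrow> (nat \<times> nat) set" where
  "cells n p = {(i, j). 1 \<le> i \<and> 1 \<le> j \<and> j \<le> n \<and> p j \<le> int j - int i}"

definition fillings :: "nat \<Rightarrow> (nat \<times> nat) set \<Rightarrow> (nat \<times> nat \<Rightarrow> nat) set" where
  "fillings N D = {m \<in> D \<rightarrow>\<^sub>E {0<..<N}.
     (\<forall>i j. (i, j) \<in> D \<and> (i + 1, j) \<in> D \<longrightarrow> m (i, j) \<le> m (i + 1, j)) \<and>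
     (\<forall>i j. (i, j) \<in> D \<and> (i, j + 1) \<in> D \<longrightarrow> m (i, j) \<le> m (i, j + 1)) \<and>
     (\<forall>i j. (i, j) \<in> D \<and> (i + 1, j + 1) \<in> D \<longrightarrow> m (i, j) < m (i + 1, j + 1))}"

text \<open>Spreads the powers of \<open>t\<close> and \<open>1 - t\<close> over the cells: each
  equality is charged to its upper or left cell.\<close>

definition cell_weight ::
  "(nat \<Rightarrow> int \<Rightarrow> 'a::comm_ring_1) \<Rightarrow> 'a \<Rightarrow> (nat \<times> nat) set \<Rightarrow> (nat \<times> nat \<Rightarrow> nat) \<Rightarrow> nat \<times> nat \<Rightarrow> 'a"
where
  "cell_weight x t D m = (\<lambda>(i, j). x (m (i, j)) (int j - int i) *
     (if (i + 1, j) \<in> D \<and> m (i, j) = m (i + 1, j) then t else 1) *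
     (if (i, j + 1) \<in> D \<and> m (i, j) = m (i, j + 1) then 1 - t else 1))"

definition tableau_sum ::
  "(nat \<Rightarrow> int \<Rightarrow> 'a::comm_ring_1) \<Rightarrow> 'a \<Rightarrow> nat \<Rightarrow> (nat \<times> nat) set \<Rightarrow> 'a" where
  "tableau_sum x t N D = (\<Sum>m\<in>fillings N D. \<Prod>c\<in>D. cell_weight x t D m c)"

lemma finite_fillings: "finite D \<Longrightarrow> finite (fillings N D)"
  by (rule finite_subset [of _ "D \<rightarrow>\<^sub>E {0<..<N}"]) (auto simp: fillings_def intro: finite_PiE)

lemma finite_cells: "finite (cells n p)"
proof (rule finite_subset)
  show "cells n p \<subseteq> (\<Union>j\<in>{1..n}. {1..nat (int j - p j)} \<times> {j})"
    by (auto simp: cells_def)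
qed auto

lemma shape_step: "shape n p \<Longrightarrow> 1 \<le> j \<Longrightarrow> j < n \<Longrightarrow> p j < p (j + 1)"
  by (force simp: shape_def next_content_def)

text \<open>The last column gives \<open>p n \<le> n\<close>, and strict increase carries the bound
  to the left. Column heights are thus nonnegative.\<close>

lemma shape_le:
  assumes "shape n p" "j \<in> {1..n}"
  shows "p j \<le> int j"
proof -
  have "j \<le> n" using assms by simp
  then have "1 \<le> j \<Longrightarrow> p j \<le> int j"
  proof (induction rule: inc_induct)
    case base
    have "n \<in> {1..n}" using base by simp
    then have "p n < next_content n p n"
      using assms(1) unfolding shape_def by blast
    then show ?case by (simp add: next_content_def)
  next
    case (step j)
    then show ?case using shape_step [OF assms(1), of j] by simp
  qed
  then show ?thesis using assms by simp
qed

lemma initial_segment: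
  fixes A :: "nat set"
  assumes "finite A" "0 \<notin> A" and down: "\<And>i. 1 \<le> i \<Longrightarrow> Suc i \<in> A \<Longrightarrow> i \<in> A"
  shows "A = {1..card A}"
proof (cases "A = {}")
  case False
  have "i \<in> A" if "i \<le> Max A" "1 \<le> i" for i
    using that
  proof (induction rule: inc_induct)
    case base
    show ?case using assms(1) False by (rule Max_in)
  next
    case (step i)
    show ?case by (rule down) (use step in auto)
  qed
  moreover have "i \<le> Max A" if "i \<in> A" for i
    using assms(1) that by (rule Max_ge)
  moreover have "1 \<le> i" if "i \<in> A" for i
    using that assms(2) by (cases i) auto
  ultimately have *: "{1..Max A} = A"
    by (meson atLeastAtMost_iff equalityI subsetI)
  have "card A = Max A"
    using arg_cong [OF *, of card] by simp
  then show ?thesis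
    by (simp only: *)
qed auto

section \<open>Removing the largest entry from a tableau\<close>

text \<open>Restriction to \<open>Q\<close> is a bijection onto \<open>fillings N Q\<close>,
  inverted by putting \<open>N\<close> on \<open>P - Q\<close>. There \<open>down\<close> and
  \<open>right\<close> keep columns and rows monotone, and \<open>diag\<close> prevents diagonally
  adjacent entries \<open>N\<close>.\<close>

lemma tableau_sum_fibre:
  assumes P: "finite P" "Q \<subseteq> P" and "0 < N"
    and down: "\<And>i j. (i, j) \<in> P \<Longrightarrow> (i + 1, j) \<in> Q \<Longrightarrow> (i, j) \<in> Q"
    and right: "\<And>i j. (i, j) \<in> P \<Longrightarrow> (i, j + 1) \<in> Q \<Longrightarrow> (i, j) \<in> Q"
    and diag: "\<And>i j. (i, j) \<in> P \<Longrightarrow> (i + 1, j + 1) \<in> P \<Longrightarrow> (i, j) \<in> Q"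
  shows "(\<Sum>m | m \<in> fillings (Suc N) P \<and> {c \<in> P. m c < N} = Q. \<Prod>c\<in>P. cell_weight x t P m c) =
    (\<Prod>(i, j)\<in>P - Q. x N (int j - int i) * (if (i + 1, j) \<in> P then t else 1) *
      (if (i, j + 1) \<in> P then 1 - t else 1)) * tableau_sum x t N Q"
proof -
  define ext where "ext m' = (\<lambda>c. if c \<in> Q then m' c else if c \<in> P then N else undefined)"
    for m' :: "nat \<times> nat \<Rightarrow> nat"
  let ?F = "{m \<in> fillings (Suc N) P. {c \<in> P. m c < N} = Q}"
  let ?v = "\<lambda>(i, j). x N (int j - int i) * (if (i + 1, j) \<in> P then t else 1) *
      (if (i, j + 1) \<in> P then 1 - t else 1)"
  have F_N: "m c = N" if "m \<in> ?F" "c \<in> P - Q" for m c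
  proof -
    have "m c < Suc N" "\<not> m c < N" using that by (auto simp: fillings_def)
    then show ?thesis by simp
  qed
  have F_lt: "m c < N" if "m \<in> ?F" "c \<in> Q" for m c
    using that by blast
  have "(\<Sum>m\<in>?F. \<Prod>c\<in>P. cell_weight x t P m c) =
      (\<Sum>m'\<in>fillings N Q. (\<Prod>c\<in>P - Q. ?v c) * (\<Prod>c\<in>Q. cell_weight x t Q m' c))"
  proof (rule sum.reindex_bij_witness [of _ ext "\<lambda>m. restrict m Q"])
    fix m assume m: "m \<in> ?F"
    show "ext (restrict m Q) = m"
      using F_N [OF m] m P(2) by (auto simp: ext_def fun_eq_iff fillings_def PiE_def extensional_def)
    show "restrict m Q \<in> fillings N Q"
      using m F_lt [OF m] P(2) by (auto simp: fillings_def PiE_iff)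
    have "(\<Prod>c\<in>P. cell_weight x t P m c) =
        (\<Prod>c\<in>P - Q. cell_weight x t P m c) * (\<Prod>c\<in>Q. cell_weight x t P m c)"
      using P by (simp add: prod.subset_diff)
    also have "(\<Prod>c\<in>P - Q. cell_weight x t P m c) = (\<Prod>c\<in>P - Q. ?v c)"
    proof (intro prod.cong refl)
      fix c assume c: "c \<in> P - Q"
      obtain i j where ij: "c = (i, j)" by (cases c)
      \<comment> \<open>Neighbours below or to the right of a cell outside \<open>Q\<close> are
        outside \<open>Q\<close> too, hence carry \<open>N\<close>.\<close>
      have "m (i + 1, j) = N" if "(i + 1, j) \<in> P"
        using F_N [OF m, of "(i + 1, j)"] down [of i j] c that by (auto simp: ij)
      moreover have "m (i, j + 1) = N" if "(i, j + 1) \<in> P"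
        using F_N [OF m, of "(i, j + 1)"] right [of i j] c that by (auto simp: ij)
      ultimately show "cell_weight x t P m c = ?v c"
        using F_N [OF m c] by (auto simp: cell_weight_def ij)
    qed
    also have "(\<Prod>c\<in>Q. cell_weight x t P m c) = (\<Prod>c\<in>Q. cell_weight x t Q (restrict m Q) c)"
    proof (intro prod.cong refl)
      fix c assume c: "c \<in> Q"
      obtain i j where ij: "c = (i, j)" by (cases c)
      \<comment> \<open>A cell of \<open>P\<close> sharing an entry below \<open>N\<close> lies in
        \<open>Q\<close>, so restriction loses no equality.\<close>
      have "d \<in> P \<and> m c = m d \<longleftrightarrow> d \<in> Q \<and> m c = m d" for d
      proof -
        have "d \<in> P \<and> m d < N \<longleftrightarrow> d \<in> Q"
          using m by blast
        then show ?thesis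
          using F_lt [OF m c] by auto
      qed
      from this [of "(i + 1, j)"] this [of "(i, j + 1)"]
      have "cell_weight x t P m c = cell_weight x t Q m c"
        by (simp add: cell_weight_def ij)
      also have "\<dots> = cell_weight x t Q (restrict m Q) c"
        using c by (simp add: cell_weight_def ij)
      finally show "cell_weight x t P m c = cell_weight x t Q (restrict m Q) c" .
    qed
    finally show "(\<Prod>c\<in>P - Q. ?v c) * (\<Prod>c\<in>Q. cell_weight x t Q (restrict m Q) c) =
        (\<Prod>c\<in>P. cell_weight x t P m c)" ..
  next
    fix m' assume m': "m' \<in> fillings N Q"
    have lt: "0 < m' c" "m' c < N" if "c \<in> Q" for c
      using m' that by (auto simp: fillings_def PiE_iff)
    show "restrict (ext m') Q = m'"
      using m' by (auto simp: ext_def fun_eq_iff fillings_def PiE_def extensional_def)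
    have "ext m' \<in> P \<rightarrow>\<^sub>E {0<..<Suc N}"
      using lt P(2) \<open>0 < N\<close> by (fastforce simp: ext_def PiE_iff extensional_def)
    moreover have "ext m' (i, j) \<le> ext m' (i + 1, j)" if "(i, j) \<in> P" "(i + 1, j) \<in> P" for i j
      using that m' lt(2) [of "(i, j)"] down [of i j] by (auto simp: ext_def fillings_def)
    moreover have "ext m' (i, j) \<le> ext m' (i, j + 1)" if "(i, j) \<in> P" "(i, j + 1) \<in> P" for i j
      using that m' lt(2) [of "(i, j)"] right [of i j] by (auto simp: ext_def fillings_def)
    moreover have "ext m' (i, j) < ext m' (i + 1, j + 1)" if "(i, j) \<in> P" "(i + 1, j + 1) \<in> P" for i j
      using that m' lt(2) [of "(i, j)"] diag [of i j] by (auto simp: ext_def fillings_def)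
    moreover have "{c \<in> P. ext m' c < N} = Q"
      using lt P(2) by (auto simp: ext_def)
    ultimately show "ext m' \<in> ?F"
      by (auto simp: fillings_def)
  qed
  then show ?thesis
    by (simp add: tableau_sum_def sum_distrib_left)
qed

text \<open>Here \<open>s\<close> is the content of a cell with entry \<open>N\<close>: all but the
  bottom one have a cell below, and \<open>s = p' - 1\<close> occurs exactly when
  \<open>q = p'\<close>.\<close>

lemma strip_weight_eq_prod:
  assumes "p \<le> q" "q \<le> p'" "p < p'"
  shows "(\<Prod>s=p..<q. x N s * (if p < s then t else 1) * (if s + 1 = p' then 1 - t else 1)) =
    strip_weight x t N p p' q"
proof -
  have "{p..<q} \<inter> {s. p < s} = {p + 1..<q}" by auto
  then have "(\<Prod>s=p..<q. if p < s then t else 1) = t ^ nat (q - p - 1)"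
    by (simp add: prod.If_cases algebra_simps)
  moreover have "(\<Prod>s=p..<q. if s + 1 = p' then 1 - t else 1) = (if q = p' then 1 - t else 1)"
  proof -
    have "(\<Prod>s=p..<q. if s + 1 = p' then 1 - t else 1) = (\<Prod>s=p..<q. if s = p' - 1 then 1 - t else 1)"
      by (intro prod.cong) auto
    then show ?thesis using assms by auto
  qed
  ultimately show ?thesis
    by (simp add: strip_weight_def prod.distrib mult.commute)
qed

lemma cells_subset_imp_le:
  assumes "cells n q \<subseteq> cells n q'" "shape n q'" "j \<in> {1..n}"
  shows "q' j \<le> q j"
proof (rule ccontr)
  assume "\<not> ?thesis"
  \<comment> \<open>The witness is the bottom cell of column \<open>j\<close> in
    \<open>cells n q\<close>; its row is positive because \<open>q j < q' j \<le> j\<close>.\<close>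
  with shape_le [OF assms(2,3)] have "(nat (int j - q j), j) \<in> cells n q - cells n q'"
    using assms(3) by (auto simp: cells_def)
  with assms(1) show False by blast
qed

text \<open>In coordinates column and content, column \<open>j\<close> of the difference consists of
  the contents \<open>p j\<close> to \<open>q j - 1\<close>.\<close>

lemma prod_strip_cells:
  assumes "shape n p" "shape n q" and q: "\<And>j. j \<in> {1..n} \<Longrightarrow> p j \<le> q j \<and> q j \<le> next_content n p j"
  shows "(\<Prod>(i, j)\<in>cells n p - cells n q. x N (int j - int i) *
      (if (i + 1, j) \<in> cells n p then t else 1) * (if (i, j + 1) \<in> cells n p then 1 - t else 1)) =
    (\<Prod>j=1..n. strip_weight x t N (p j) (next_content n p j) (q j))" (is "prod ?f _ = _")
proof -
  have "prod ?f (cells n p - cells n q) =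
      (\<Prod>(j, s)\<in>(SIGMA j:{1..n}. {p j..<q j}). x N s * (if p j < s then t else 1) *
        (if s + 1 = next_content n p j then 1 - t else 1))"
  proof (rule prod.reindex_bij_witness [of _ "\<lambda>(j, s). (nat (int j - s), j)" "\<lambda>(i, j). (j, int j - int i)"])
    fix b assume "b \<in> (SIGMA j:{1..n}. {p j..<q j})"
    then obtain j s where b: "b = (j, s)" "j \<in> {1..n}" "p j \<le> s" "s < q j" by auto
    with shape_le [OF assms(2), of j]
    show "(case case b of (j, s) \<Rightarrow> (nat (int j - s), j) of (i, j) \<Rightarrow> (j, int j - int i)) = b"
      "(case b of (j, s) \<Rightarrow> (nat (int j - s), j)) \<in> cells n p - cells n q"
      by (auto simp: cells_def)
  next
    fix c assume "c \<in> cells n p - cells n q"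
    moreover obtain i j where ij: "c = (i, j)" by (cases c)
    ultimately have c: "c = (i, j)" "1 \<le> i" "j \<in> {1..n}" "p j \<le> int j - int i" "int j - int i < q j"
      by (auto simp: cells_def)
    then show "(case case c of (i, j) \<Rightarrow> (j, int j - int i) of (j, s) \<Rightarrow> (nat (int j - s), j)) = c"
      "(case c of (i, j) \<Rightarrow> (j, int j - int i)) \<in> (SIGMA j:{1..n}. {p j..<q j})"
      by auto
    have "(i + 1, j) \<in> cells n p \<longleftrightarrow> p j < int j - int i"
      using c by (auto simp: cells_def)
    \<comment> \<open>The right neighbour has content at most \<open>q j\<close>, so it can only be
      the bottom cell of the next column. For \<open>j = n\<close> both sides are false, as
      \<open>i\<close> is positive.\<close>
    moreover have "(i, j + 1) \<in> cells n p \<longleftrightarrow> int j - int i + 1 = next_content n p j"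
      using c q [OF c(3)] shape_le [OF assms(2), of j] by (auto simp: cells_def next_content_def)
    ultimately show "(case case c of (i, j) \<Rightarrow> (j, int j - int i) of
        (j, s) \<Rightarrow> x N s * (if p j < s then t else 1) * (if s + 1 = next_content n p j then 1 - t else 1)) = ?f c"
      by (simp add: c(1))
  qed
  also have "\<dots> = (\<Prod>j=1..n. \<Prod>s=p j..<q j. x N s * (if p j < s then t else 1) *
        (if s + 1 = next_content n p j then 1 - t else 1))"
    by (rule prod.Sigma [symmetric]) auto
  also have "\<dots> = (\<Prod>j=1..n. strip_weight x t N (p j) (next_content n p j) (q j))"
    using assms by (intro prod.cong strip_weight_eq_prod refl) (auto simp: shape_def)
  finally show ?thesis .
qed

text \<open>Monotone columns make the entries below \<open>N\<close> an initial piece of each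
  column, monotone rows make these pieces a shape, and the diagonal condition bounds
  \<open>q\<close> from above.\<close>

lemma fillings_inner_shape:
  assumes p: "shape n p" and m: "m \<in> fillings (Suc N) (cells n p)"
  obtains q where "q \<in> PiE {1..n} (\<lambda>j. {p j..next_content n p j})" "shape n q"
    "{c \<in> cells n p. m c < N} = cells n q"
proof -
  define A where "A j = {i. (i, j) \<in> cells n p \<and> m (i, j) < N}" for j
  define c where "c j = card (A j)" for j
  define q where "q = restrict (\<lambda>j. int j - int (c j)) {1..n}"
  have A: "A j = {1..c j}" for j
    unfolding c_def
  proof (rule initial_segment)
    have "A j \<subseteq> fst ` cells n p" by (force simp: A_def)
    then show "finite (A j)" by (rule finite_subset) (simp add: finite_cells)
    show "0 \<notin> A j" by (simp add: A_def cells_def)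
  next
    fix i assume i: "1 \<le> i" "Suc i \<in> A j"
    then have *: "(i, j) \<in> cells n p" "(i + 1, j) \<in> cells n p" "m (i + 1, j) < N"
      by (auto simp: A_def cells_def)
    then have "m (i, j) \<le> m (i + 1, j)"
      using m unfolding fillings_def by blast
    with * show "i \<in> A j" by (simp add: A_def)
  qed
  have A_iff: "(i, j) \<in> cells n p \<and> m (i, j) < N \<longleftrightarrow> 1 \<le> i \<and> i \<le> c j" for i j
  proof -
    have "i \<in> A j \<longleftrightarrow> 1 \<le> i \<and> i \<le> c j" by (subst A) simp
    then show ?thesis by (simp add: A_def)
  qed
  have lower: "p j \<le> q j" if j: "j \<in> {1..n}" for j
    using A_iff [of "c j" j] shape_le [OF p j] j
    by (cases "c j = 0") (auto simp: q_def cells_def)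
  have upper: "q j \<le> next_content n p j" if j: "j \<in> {1..n}" for j
  proof (cases "j = n")
    case False
    show ?thesis
    proof (rule ccontr)
      assume neg: "\<not> ?thesis"
      \<comment> \<open>\<open>(c j + 1, j)\<close> is the highest cell of column \<open>j\<close>
        with entry \<open>N\<close>; the cell diagonally below it would need a larger entry.\<close>
      have "(c j + 1 + 1, j + 1) \<in> cells n p" "(c j + 1, j) \<in> cells n p"
        using neg False j shape_step [OF p, of j] by (auto simp: q_def next_content_def cells_def)
      then have "m (c j + 1, j) < m (c j + 1 + 1, j + 1)" "m (c j + 1 + 1, j + 1) < Suc N"
        using m unfolding fillings_def by (blast, auto)
      with A_iff [of "c j + 1" j] \<open>(c j + 1, j) \<in> cells n p\<close> show False by simp
    qed
  qed (use j in \<open>simp add: q_def next_content_def\<close>)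
  have "c (j + 1) \<le> c j" if j: "1 \<le> j" "j < n" for j
  proof (cases "c (j + 1) = 0")
    case False
    then have *: "(c (j + 1), j + 1) \<in> cells n p" "m (c (j + 1), j + 1) < N"
      using A_iff [of "c (j + 1)" "j + 1"] by auto
    then have "(c (j + 1), j) \<in> cells n p"
      using j shape_step [OF p, of j] by (auto simp: cells_def)
    moreover from this have "m (c (j + 1), j) \<le> m (c (j + 1), j + 1)"
      using m * unfolding fillings_def by blast
    ultimately show ?thesis
      using * A_iff [of "c (j + 1)" j] by simp
  qed simp
  then have "shape n q"
    by (fastforce simp: shape_def q_def next_content_def)
  moreover have "q \<in> PiE {1..n} (\<lambda>j. {p j..next_content n p j})"
    using lower upper by (auto simp: PiE_iff) (simp add: q_def)
  moreover have "{c \<in> cells n p. m c < N} = cells n q"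
  proof (rule Set.set_eqI)
    fix d :: "nat \<times> nat"
    obtain i j where d: "d = (i, j)" by (cases d)
    have "(i, j) \<in> cells n p \<and> m (i, j) < N \<longleftrightarrow> (i, j) \<in> cells n q"
    proof (cases "j \<in> {1..n}")
      case True
      then show ?thesis unfolding A_iff by (auto simp: cells_def q_def)
    qed (auto simp: cells_def)
    then show "d \<in> {c \<in> cells n p. m c < N} \<longleftrightarrow> d \<in> cells n q"
      by (simp add: d)
  qed
  ultimately show thesis using that by blast
qed

text \<open>Fillings are grouped by the set of cells with entries below \<open>N\<close>, which
  determines \<open>q\<close>. The outcome is the recursion of
  \<open>chain_det_step\<close>.\<close>

lemma tableau_sum_step:
  assumes "0 < N" and p: "shape n p"
  shows "tableau_sum x t (Suc N) (cells n p) =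
    (\<Sum>q | q \<in> PiE {1..n} (\<lambda>j. {p j..next_content n p j}) \<and> shape n q.
      (\<Prod>j=1..n. strip_weight x t N (p j) (next_content n p j) (q j)) * tableau_sum x t N (cells n q))"
    (is "_ = (\<Sum>q\<in>?Q. ?w q * _)")
proof -
  let ?F = "fillings (Suc N) (cells n p)" and ?W = "\<lambda>m. \<Prod>c\<in>cells n p. cell_weight x t (cells n p) m c"
  let ?in = "\<lambda>m. {c \<in> cells n p. m c < N}"
  have "finite ?Q" by (rule finite_subset [of _ "PiE {1..n} (\<lambda>j. {p j..next_content n p j})"]) (auto intro: finite_PiE)
  have inj: "inj_on (cells n) ?Q"
  proof (rule inj_onI)
    fix q q' assume "q \<in> ?Q" "q' \<in> ?Q" and eq: "cells n q = cells n q'"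
    then have "q j = q' j" if "j \<in> {1..n}" for j
      using that by (intro antisym cells_subset_imp_le [of n]) auto
    with \<open>q \<in> ?Q\<close> \<open>q' \<in> ?Q\<close> show "q = q'"
      by (auto intro!: PiE_ext [of q "{1..n}" "\<lambda>j. {p j..next_content n p j}" q'])
  qed
  have "?in ` ?F \<subseteq> cells n ` ?Q"
  proof safe
    fix m assume "m \<in> ?F"
    from fillings_inner_shape [OF p this] show "?in m \<in> cells n ` ?Q" by (metis (mono_tags) imageI mem_Collect_eq)
  qed
  then have "sum ?W ?F = (\<Sum>D\<in>cells n ` ?Q. \<Sum>m | m \<in> ?F \<and> ?in m = D. ?W m)"
    using \<open>finite ?Q\<close> finite_fillings [OF finite_cells] by (intro sum.group [symmetric]) auto
  also have "\<dots> = (\<Sum>q\<in>?Q. \<Sum>m | m \<in> ?F \<and> ?in m = cells n q. ?W m)"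
    by (subst sum.reindex [OF inj]) (simp only: o_def)
  also have "\<dots> = (\<Sum>q\<in>?Q. ?w q * tableau_sum x t N (cells n q))"
  proof (intro sum.cong refl)
    fix q assume q: "q \<in> ?Q"
    then have bd: "p j \<le> q j \<and> q j \<le> next_content n p j" if "j \<in> {1..n}" for j
      using that by (auto simp: PiE_iff)
    have sq: "shape n q" using q by simp
    have "(\<Sum>m | m \<in> ?F \<and> ?in m = cells n q. ?W m) =
      (\<Prod>(i, j)\<in>cells n p - cells n q. x N (int j - int i) * (if (i + 1, j) \<in> cells n p then t else 1) *
      (if (i, j + 1) \<in> cells n p then 1 - t else 1)) * tableau_sum x t N (cells n q)"
    proof (rule tableau_sum_fibre [OF finite_cells _ assms(1)])
      show "cells n q \<subseteq> cells n p" using bd by (fastforce simp: cells_def)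
      show "(i, j) \<in> cells n q" if "(i, j) \<in> cells n p" "(i + 1, j) \<in> cells n q" for i j
        using that by (auto simp: cells_def)
      show "(i, j) \<in> cells n q" if "(i, j) \<in> cells n p" "(i, j + 1) \<in> cells n q" for i j
        using that shape_step [OF sq, of j] by (auto simp: cells_def)
      \<comment> \<open>The second cell gives \<open>p (j + 1) \<le> j - i\<close>, and
        \<open>q j \<le> p (j + 1)\<close>.\<close>
      show "(i, j) \<in> cells n q" if "(i, j) \<in> cells n p" "(i + 1, j + 1) \<in> cells n p" for i j
        using that bd [of j] by (auto simp: cells_def next_content_def split: if_splits)
    qed
    also have "\<dots> = ?w q * tableau_sum x t N (cells n q)"
      by (subst prod_strip_cells [OF p sq bd]) auto
    finally show "(\<Sum>m | m \<in> ?F \<and> ?in m = cells n q. ?W m) = ?w q * tableau_sum x t N (cells n q)" .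
  qed
  finally show ?thesis by (simp add: tableau_sum_def)
qed

section \<open>The base case and the identity for truncated sums\<close>

lemma tableau_sum_1:
  "tableau_sum x t 1 D = (if D = {} then 1 else 0)"
proof (cases "D = {}")
  case True
  have "fillings 1 {} = {\<lambda>_. undefined}"
    by (auto simp: fillings_def)
  then show ?thesis using True by (simp add: tableau_sum_def)
next
  case False
  then have "fillings 1 D = {}"
    by (auto simp: fillings_def PiE_iff)
  then show ?thesis using False by (simp add: tableau_sum_def)
qed

lemma chain_sum_1: "chain_sum x t 1 p j = (if p = j then 1 else 0)"
proof -
  have "seqs 1 r = {}" if "r \<noteq> 0" for r
  proof -
    have "{0<..<1::nat} = {}" by auto
    then show ?thesis using that by (simp add: seqs_def) auto
  qed
  then show ?thesis
    by (cases "p = j") (auto simp: chain_sum_def)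
qed

text \<open>For \<open>N = 1\<close> the chain sums are Kronecker deltas. Without cells
  \<open>p j = j\<close> gives the identity matrix; otherwise \<open>p 1 < 1\<close> by strict
  increase, and the first row vanishes.\<close>

lemma chain_det_1:
  assumes p: "shape n p"
  shows "chain_det x t 1 n p = (if cells n p = {} then 1 else 0)"
proof (cases "cells n p = {}")
  case True
  have "p j = int j" if j: "j \<in> {1..n}" for j
  proof -
    have "(1, j) \<notin> cells n p" using True by simp
    then show ?thesis using j shape_le [OF p j] by (auto simp: cells_def)
  qed
  then have "Matrix.mat n n (\<lambda>(i, j). chain_sum x t 1 (p (i + 1)) (int (j + 1))) = 1\<^sub>m n"
    unfolding chain_sum_1 by (intro eq_matI) auto
  then show ?thesis using True by (simp add: chain_det_def)
next
  case False
  then obtain i j where j: "1 \<le> j" "j \<le> n" "p j < int j"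
    by (fastforce simp: cells_def)
  from j(1) have "p 1 < int 1"
  proof (induction rule: inc_induct)
    case (step k)
    then show ?case using shape_step [OF p, of k] j(2) by simp
  qed (use j in simp)
  then have "chain_det x t 1 n p = 0"
    unfolding chain_det_def chain_sum_1 using j by (intro det_row_eq_0 [of _ n 0]) auto
  then show ?thesis using False by simp
qed

text \<open>Both sides obey the same recursion in \<open>N\<close>, which passes to other shapes
  \<open>q\<close>; hence the induction treats all shapes at once.\<close>

theorem tableau_sum_eq_chain_det:
  assumes "0 < N" "shape n p"
  shows "tableau_sum x t N (cells n p) = chain_det x t N n p"
  using assms
proof (induction N arbitrary: p rule: nat_induct_non_zero)
  case 1
  then show ?case by (simp only: tableau_sum_1 chain_det_1)
next
  case (Suc N)
  then show ?case
    by (simp add: tableau_sum_step chain_det_step del: prod.cl_ivl_Suc)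
qed

section \<open>Limits\<close>

lemma coeffwise_LIMSEQ_const: "coeffwise_LIMSEQ (\<lambda>_. p) p"
  by (simp add: coeffwise_LIMSEQ_def)

lemma coeffwise_LIMSEQ_mult:
  "coeffwise_LIMSEQ f p \<Longrightarrow> coeffwise_LIMSEQ g q \<Longrightarrow> coeffwise_LIMSEQ (\<lambda>N. f N * g N) (p * q)"
  by (auto simp: coeffwise_LIMSEQ_def coeff_mult intro!: tendsto_sum tendsto_mult)

lemma coeffwise_LIMSEQ_sum:
  "(\<And>i. i \<in> I \<Longrightarrow> coeffwise_LIMSEQ (f i) (p i)) \<Longrightarrow>
    coeffwise_LIMSEQ (\<lambda>N. \<Sum>i\<in>I. f i N) (\<Sum>i\<in>I. p i)"
  by (auto simp: coeffwise_LIMSEQ_def coeff_sum intro!: tendsto_sum)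

lemma coeffwise_LIMSEQ_prod:
  "(\<And>i. i \<in> I \<Longrightarrow> coeffwise_LIMSEQ (f i) (p i)) \<Longrightarrow>
    coeffwise_LIMSEQ (\<lambda>N. \<Prod>i\<in>I. f i N) (\<Prod>i\<in>I. p i)"
  by (induction I rule: infinite_finite_induct)
    (auto intro: coeffwise_LIMSEQ_const coeffwise_LIMSEQ_mult)

lemma coeffwise_LIMSEQ_det:
  assumes "\<And>i j. i < n \<Longrightarrow> j < n \<Longrightarrow> coeffwise_LIMSEQ (\<lambda>N. f N i j) (p i j)"
  shows "coeffwise_LIMSEQ (\<lambda>N. Determinant.det (Matrix.mat n n (\<lambda>(i, j). f N i j)))
    (Determinant.det (Matrix.mat n n (\<lambda>(i, j). p i j)))"
proof -
  have eq: "Determinant.det (Matrix.mat n n (\<lambda>(i, j). g i j)) =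
      (\<Sum>\<pi> | \<pi> permutes {0..<n}. signof \<pi> * (\<Prod>i=0..<n. g i (\<pi> i)))" for g :: "nat \<Rightarrow> nat \<Rightarrow> real poly"
    by (auto simp: Determinant.det_def intro!: sum.cong prod.cong)
  have "\<pi> i < n" if "\<pi> permutes {0..<n}" "i \<in> {0..<n}" for \<pi> i
    using permutes_in_image [OF that(1), of i] that(2) by simp
  then show ?thesis
    unfolding eq
    by (intro coeffwise_LIMSEQ_sum coeffwise_LIMSEQ_mult coeffwise_LIMSEQ_const
        coeffwise_LIMSEQ_prod assms) auto
qed

section \<open>Convergence of interpolated zeta values\<close>

lemma seqs_exhaust:
  fixes F :: "nat list set"
  assumes "finite F" "F \<subseteq> {ms. length ms = r \<and> sorted ms \<and> (\<forall>m\<in>set ms. 0 < m)}"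
  obtains N where "F \<subseteq> seqs N r"
proof -
  have "finite (\<Union>ms\<in>F. set ms)" using assms(1) by simp
  then obtain N where "\<forall>m\<in>(\<Union>ms\<in>F. set ms). m < N"
    unfolding finite_nat_set_iff_bounded by blast
  then have "F \<subseteq> seqs N r"
    using assms(2) by (fastforce simp: seqs_def)
  then show thesis by (rule that)
qed

text \<open>Turns a \<open>has_sum\<close> over all chains into a limit of truncated sums.\<close>

lemma seqs_filterlim:
  "filterlim (\<lambda>N. seqs N r) (finite_subsets_at_top {ms. length ms = r \<and> sorted ms \<and> (\<forall>m\<in>set ms. 0 < m)})
    sequentially"
  unfolding filterlim_finite_subsets_at_top
proof (intro allI impI)
  fix F :: "nat list set"
  assume F: "finite F \<and> F \<subseteq> {ms. length ms = r \<and> sorted ms \<and> (\<forall>m\<in>set ms. 0 < m)}"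
  then obtain N where N: "F \<subseteq> seqs N r"
    using seqs_exhaust by blast
  have "F \<subseteq> seqs M r" if "N \<le> M" for M
    using N that by (fastforce simp: seqs_def)
  moreover have "seqs M r \<subseteq> {ms. length ms = r \<and> sorted ms \<and> (\<forall>m\<in>set ms. 0 < m)}" for M
    by (auto simp: seqs_def)
  ultimately show "\<forall>\<^sub>F M in sequentially. finite (seqs M r) \<and> F \<subseteq> seqs M r \<and>
      seqs M r \<subseteq> {ms. length ms = r \<and> sorted ms \<and> (\<forall>m\<in>set ms. 0 < m)}"
    unfolding eventually_sequentially using finite_seqs by blast
qed

text \<open>Forgetting the order between the last entry and the others makes the sum factor, with a
  bound uniform in \<open>N\<close>. The series term at 0 is 0, as
  \<open>inverse 0 = 0\<close>.\<close>

lemma sum_inverse_squares_seqs_le: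
  "(\<Sum>ms\<in>seqs N r. \<Prod>i<r. inverse (real (ms ! i) ^ 2)) \<le> (\<Sum>n. inverse (real n ^ 2)) ^ r"
proof (induction r)
  case (Suc r)
  let ?f = "\<lambda>n. inverse (real n ^ 2)"
  let ?w = "\<lambda>r ms. \<Prod>i<r. ?f (ms ! i)"
  have "seqs N (Suc r) \<subseteq> (\<lambda>(ms, m). ms @ [m]) ` (seqs N r \<times> {0<..<N})"
  proof
    fix ms assume ms: "ms \<in> seqs N (Suc r)"
    then obtain ms' m where "ms = ms' @ [m]"
      by (cases ms rule: rev_cases) (auto simp: seqs_def)
    with ms show "ms \<in> (\<lambda>(ms, m). ms @ [m]) ` (seqs N r \<times> {0<..<N})"
      by (auto simp: seqs_def sorted_append intro!: image_eqI [of _ _ "(ms', m)"])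
  qed
  then have "(\<Sum>ms\<in>seqs N (Suc r). ?w (Suc r) ms) \<le>
      (\<Sum>ms\<in>(\<lambda>(ms, m). ms @ [m]) ` (seqs N r \<times> {0<..<N}). ?w (Suc r) ms)"
    by (intro sum_mono2) (auto intro!: prod_nonneg simp del: prod.lessThan_Suc)
  also have "\<dots> = (\<Sum>(ms, m)\<in>seqs N r \<times> {0<..<N}. ?w (Suc r) (ms @ [m]))"
    by (subst sum.reindex) (auto simp: inj_on_def case_prod_unfold simp del: prod.lessThan_Suc)
  also have "\<dots> = (\<Sum>(ms, m)\<in>seqs N r \<times> {0<..<N}. ?w r ms * ?f m)"
  proof (intro sum.cong refl, safe)
    fix ms m assume "ms \<in> seqs N r"
    then have "length ms = r" by (simp add: seqs_def)
    then show "?w (Suc r) (ms @ [m]) = ?w r ms * ?f m"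
      by (auto simp: nth_append)
  qed
  also have "\<dots> = (\<Sum>ms\<in>seqs N r. ?w r ms) * (\<Sum>m\<in>{0<..<N}. ?f m)"
    by (simp add: sum_product sum.cartesian_product)
  also have "\<dots> \<le> (\<Sum>n. ?f n) ^ r * (\<Sum>n. ?f n)"
  proof (intro mult_mono Suc.IH)
    have "summable ?f" by (rule inverse_power_summable) simp
    then show "(\<Sum>m\<in>{0<..<N}. ?f m) \<le> (\<Sum>n. ?f n)" "0 \<le> (\<Sum>n. ?f n) ^ r"
      by (auto intro!: sum_le_suminf zero_le_power suminf_nonneg)
  qed (auto intro!: sum_nonneg)
  finally show ?case by (simp add: mult.commute)
qed simp

text \<open>Exponents at least 2 allow comparison with inverse squares. The function
  \<open>g\<close> leaves room for a single polynomial coefficient, which is the weight or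
  0.\<close>

lemma mzv_weight_summable:
  fixes ks :: "int list" and g :: "nat list \<Rightarrow> real"
  assumes "\<And>k. k \<in> set ks \<Longrightarrow> 2 \<le> k"
    and "\<And>ms. 0 \<le> g ms \<and> g ms \<le> 1 / (\<Prod>i<length ks. real (ms ! i) powi (ks ! i))"
  shows "g summable_on {ms. length ms = length ks \<and> sorted ms \<and> (\<forall>m\<in>set ms. 0 < m)}"
proof (rule nonneg_bdd_above_summable_on)
  let ?A = "{ms :: nat list. length ms = length ks \<and> sorted ms \<and> (\<forall>m\<in>set ms. 0 < m)}"
  let ?r = "length ks"
  have le: "g ms \<le> (\<Prod>i<?r. inverse (real (ms ! i) ^ 2))" if "ms \<in> ?A" for ms
  proof -
    have "(\<Prod>i<?r. real (ms ! i) ^ 2) \<le> (\<Prod>i<?r. real (ms ! i) powi (ks ! i))"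
    proof (rule prod_mono)
      fix i assume "i \<in> {..<?r}"
      then have "2 \<le> ks ! i" "1 \<le> real (ms ! i)"
        using assms(1) [of "ks ! i"] that by (auto simp: Suc_le_eq)
      then show "0 \<le> real (ms ! i) ^ 2 \<and> real (ms ! i) ^ 2 \<le> real (ms ! i) powi (ks ! i)"
        using power_int_increasing [of 2 "ks ! i" "real (ms ! i)"] by simp
    qed
    moreover have "0 < (\<Prod>i<?r. real (ms ! i) ^ 2)"
      using that by (intro prod_pos) auto
    ultimately have "1 / (\<Prod>i<?r. real (ms ! i) powi (ks ! i)) \<le> 1 / (\<Prod>i<?r. real (ms ! i) ^ 2)"
      by (intro divide_left_mono) auto
    also have "\<dots> = (\<Prod>i<?r. inverse (real (ms ! i) ^ 2))"
      by (simp add: inverse_eq_divide prod_dividef)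
    finally show ?thesis using assms(2) [of ms] by linarith
  qed
  show "bdd_above (sum g ` {F. F \<subseteq> ?A \<and> finite F})"
  proof (intro bdd_aboveI2)
    fix F assume F: "F \<in> {F. F \<subseteq> ?A \<and> finite F}"
    then obtain N where N: "F \<subseteq> seqs N ?r"
      using seqs_exhaust [of F ?r] by blast
    have "sum g F \<le> (\<Sum>ms\<in>F. \<Prod>i<?r. inverse (real (ms ! i) ^ 2))"
      using F by (intro sum_mono le) auto
    also have "\<dots> \<le> (\<Sum>ms\<in>seqs N ?r. \<Prod>i<?r. inverse (real (ms ! i) ^ 2))"
      using N by (intro sum_mono2) (auto intro!: prod_nonneg)
    also note sum_inverse_squares_seqs_le
    finally show "sum g F \<le> (\<Sum>n. inverse (real n ^ 2)) ^ ?r" .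
  qed
qed (use assms(2) in auto)

text \<open>Existence of the coefficientwise sum, so that the \<open>THE\<close> in
  \<open>interp_mzv\<close> denotes it.\<close>

lemma interp_mzv_has_sum:
  assumes "\<And>k. k \<in> set ks \<Longrightarrow> 2 \<le> k"
  shows "coeffwise_has_sum
     (\<lambda>ms. smult (1 / (\<Prod>i<length ks. real (ms ! i) powi (ks ! i))) ([:0, 1:] ^ num_eq ms))
     {ms :: nat list. length ms = length ks \<and> sorted ms \<and> (\<forall>m\<in>set ms. 0 < m)} (interp_mzv ks)"
    (is "coeffwise_has_sum ?g ?A _")
proof -
  let ?w = "\<lambda>ms. 1 / (\<Prod>i<length ks. real (ms ! i) powi (ks ! i))"
  have coeff: "coeff (?g ms) n = (if num_eq ms = n then ?w ms else 0)" for ms n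
    by (simp add: monom_altdef [symmetric])
  have "0 \<le> ?w ms" for ms
    by (intro divide_nonneg_nonneg prod_nonneg) auto
  then have summable: "(\<lambda>ms. coeff (?g ms) n) summable_on ?A" for n
    unfolding coeff by (intro mzv_weight_summable assms) auto
  \<comment> \<open>A chain has at most as many equalities as entries, so coefficients of degree
    above \<open>length ks\<close> vanish.\<close>
  define P where "P = (\<Sum>n\<le>length ks. monom (\<Sum>\<^sub>\<infinity>ms\<in>?A. coeff (?g ms) n) n)"
  have "((\<lambda>ms. coeff (?g ms) n) has_sum coeff P n) ?A" for n
  proof (cases "n \<le> length ks")
    case True
    then have "coeff P n = (\<Sum>\<^sub>\<infinity>ms\<in>?A. coeff (?g ms) n)"
      by (simp add: P_def coeff_sum)
    then show ?thesis using has_sum_infsum [OF summable [of n]] by simp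
  next
    case False
    have "num_eq ms \<le> length ms" for ms
    proof -
      have "{i. Suc i < length ms \<and> ms ! i = ms ! Suc i} \<subseteq> {..<length ms}" by auto
      from card_mono [OF _ this] show ?thesis by (simp add: num_eq_def)
    qed
    then have "coeff (?g ms) n = 0" if "ms \<in> ?A" for ms
      using that False unfolding coeff by (metis (mono_tags, lifting) mem_Collect_eq)
    moreover have "coeff P n = 0"
      using False by (auto simp: P_def coeff_sum intro!: sum.neutral)
    ultimately show ?thesis
      by (simp only: has_sum_0)
  qed
  then have "coeffwise_has_sum ?g ?A P"
    by (simp add: coeffwise_has_sum_def)
  then show ?thesis
    unfolding interp_mzv_def by (rule theI [where P = "coeffwise_has_sum ?g ?A"])
      (rule coeffwise_has_sum_unique [OF _ \<open>coeffwise_has_sum ?g ?A P\<close>])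
qed

lemma smult_prod: "smult (\<Prod>c\<in>D. f c) q = (\<Prod>c\<in>D. [:f c:]) * q"
  for f :: "'b \<Rightarrow> 'a::comm_ring_1"
  by (induction D rule: infinite_finite_induct) (simp_all flip: smult_smult)

text \<open>With these constant polynomials as weights, chain sums are the truncations of the
  interpolated zeta value.\<close>

lemma chain_sum_tendsto:
  assumes a: "\<And>i. a i \<ge> 2" and "p < j"
  shows "coeffwise_LIMSEQ (\<lambda>N. chain_sum (\<lambda>n s. [:1 / real n powi a s:]) [:0, 1:] N p j)
    (interp_mzv (map (\<lambda>s. a (j - s)) [1..j - p]))"
proof -
  define ks where "ks = map (\<lambda>s. a (j - s)) [1..j - p]"
  have len: "length ks = nat (j - p)" by (simp add: ks_def)
  \<comment> \<open>The range starts at 1 but list positions at 0, whence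
    \<open>j - 1 - i\<close>.\<close>
  have nth: "ks ! i = a (j - 1 - int i)" if "i < nat (j - p)" for i
    using that by (auto simp: ks_def nth_upto algebra_simps)
  let ?g = "\<lambda>ms. smult (1 / (\<Prod>i<length ks. real (ms ! i) powi (ks ! i))) ([:0, 1:] ^ num_eq ms)"
  have "chain_sum (\<lambda>n s. [:1 / real n powi a s:]) [:0, 1:] N p j = (\<Sum>ms\<in>seqs N (length ks). ?g ms)" for N
  proof -
    have "[:0, 1:] ^ num_eq ms * (\<Prod>i<nat (j - p). [:1 / real (ms ! i) powi a (j - 1 - int i):]) = ?g ms" for ms
    proof -
      have "1 / (\<Prod>i<length ks. real (ms ! i) powi (ks ! i)) =
          (\<Prod>i<nat (j - p). 1 / real (ms ! i) powi a (j - 1 - int i))"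
        by (simp add: len nth prod_dividef)
      then show ?thesis
        by (simp only: smult_prod mult.commute)
    qed
    then show ?thesis
      using assms(2) by (simp add: chain_sum_def len)
  qed
  moreover have "coeffwise_LIMSEQ (\<lambda>N. \<Sum>ms\<in>seqs N (length ks). ?g ms) (interp_mzv ks)"
    unfolding coeffwise_LIMSEQ_def coeff_sum
  proof
    fix n
    have "coeffwise_has_sum ?g {ms. length ms = length ks \<and> sorted ms \<and> (\<forall>m\<in>set ms. 0 < m)} (interp_mzv ks)"
      by (rule interp_mzv_has_sum) (use a in \<open>auto simp: ks_def\<close>)
    then show "(\<lambda>N. \<Sum>ms\<in>seqs N (length ks). coeff (?g ms) n) \<longlonglongrightarrow> coeff (interp_mzv ks) n"
      unfolding coeffwise_has_sum_def has_sum_def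
      by (blast intro: filterlim_compose [OF _ seqs_filterlim])
  qed
  ultimately show ?thesis by (simp add: ks_def)
qed

section \<open>Partitions and their truncated zeta values\<close>

lemma tableau_zeta_trunc_eq:
  assumes "finite (diagram lam)" and "\<And>i j. (i, j) \<in> diagram lam \<Longrightarrow> k (i, j) = a (int j - int i)"
  shows "tableau_zeta_trunc N lam k =
    tableau_sum (\<lambda>n s. [:1 / real n powi a s:]) [:0, 1:] N (diagram lam)"
proof -
  let ?D = "diagram lam"
  have if_prod: "(\<Prod>c\<in>?D. if R c then y else 1) = y ^ card {c \<in> ?D. R c}" for R and y :: "real poly"
    using assms(1) by (simp add: prod.If_cases Int_def)
  have "smult (\<Prod>c\<in>?D. 1 / real (m c) powi k c) ([:0, 1:] ^ vert_eq lam m * [:1, -1:] ^ horiz_eq lam m) =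
      (\<Prod>c\<in>?D. cell_weight (\<lambda>n s. [:1 / real n powi a s:]) [:0, 1:] ?D m c)" for m
  proof -
    have t_compl: "1 - [:0, 1:] = ([:1, -1:] :: real poly)"
      by (simp add: one_pCons)
    let ?V = "\<lambda>(i, j). (i + 1, j) \<in> ?D \<and> m (i, j) = m (i + 1, j)"
    let ?H = "\<lambda>(i, j). (i, j + 1) \<in> ?D \<and> m (i, j) = m (i, j + 1)"
    have "(\<Prod>c\<in>?D. cell_weight (\<lambda>n s. [:1 / real n powi a s:]) [:0, 1:] ?D m c) =
        (\<Prod>c\<in>?D. [:1 / real (m c) powi k c:] * ((if ?V c then [:0, 1:] else 1) * (if ?H c then [:1, -1:] else 1)))"
    proof (intro prod.cong refl)
      fix c assume "c \<in> ?D"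
      moreover obtain i j where c: "c = (i, j)" by (cases c)
      ultimately have "k c = a (int j - int i)" using assms(2) by simp
      then show "cell_weight (\<lambda>n s. [:1 / real n powi a s:]) [:0, 1:] ?D m c =
          [:1 / real (m c) powi k c:] * ((if ?V c then [:0, 1:] else 1) * (if ?H c then [:1, -1:] else 1))"
        by (simp only: c cell_weight_def prod.case t_compl mult.assoc)
    qed
    also have "\<dots> = smult (\<Prod>c\<in>?D. 1 / real (m c) powi k c)
        ([:0, 1:] ^ card {c \<in> ?D. ?V c} * [:1, -1:] ^ card {c \<in> ?D. ?H c})"
      unfolding prod.distrib if_prod smult_prod ..
    also have "{c \<in> ?D. ?V c} = {(i, j). (i, j) \<in> ?D \<and> (i + 1, j) \<in> ?D \<and> m (i, j) = m (i + 1, j)}"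
      by auto
    also have "{c \<in> ?D. ?H c} = {(i, j). (i, j) \<in> ?D \<and> (i, j + 1) \<in> ?D \<and> m (i, j) = m (i, j + 1)}"
      by auto
    finally show ?thesis
      unfolding vert_eq_def horiz_eq_def ..
  qed
  then show ?thesis
    by (simp add: tableau_zeta_trunc_def tableau_sum_def OYT_def fillings_def)
qed

text \<open>Parts decrease weakly, so the rows reaching column \<open>j\<close> form an initial
  segment.\<close>

lemma conjugate_part_iff:
  assumes "is_partition lam"
  shows "1 \<le> i \<and> i \<le> length lam \<and> j \<le> lam ! (i - 1) \<longleftrightarrow> 1 \<le> i \<and> i \<le> conjugate_part lam j"
proof -
  let ?A = "{i. 1 \<le> i \<and> i \<le> length lam \<and> j \<le> lam ! (i - 1)}"
  have "?A = {1..card ?A}"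
  proof (rule initial_segment)
    show "finite ?A" by (rule finite_subset [of _ "{..length lam}"]) auto
    fix i assume i: "1 \<le> i" "Suc i \<in> ?A"
    then have "lam ! i \<le> lam ! (i - 1)"
      using assms by (intro sorted_wrt_nth_less [of "(\<ge>)"]) (auto simp: is_partition_def)
    then show "i \<in> ?A" using i by auto
  qed auto
  from arg_cong [OF this, of "\<lambda>S. i \<in> S"] show ?thesis
    unfolding conjugate_part_def mem_Collect_eq atLeastAtMost_iff .
qed

text \<open>The bottom cell of column \<open>j\<close> lies in row
  \<open>conjugate_part lam j\<close>, which gives its content; no row is longer than the
  first.\<close>

lemma diagram_eq_cells:
  assumes "is_partition lam"
  shows "diagram lam = cells (first_part lam) (\<lambda>j. int j - int (conjugate_part lam j))"
proof -
  have "lam ! (i - 1) \<le> first_part lam" if "1 \<le> i" "i \<le> length lam" for i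
    using that assms sorted_wrt_nth_less [of "(\<ge>)" lam 0 "i - 1"]
    by (cases "i = 1") (auto simp: is_partition_def first_part_def hd_conv_nth)
  then show ?thesis
    using conjugate_part_iff [OF assms] by (fastforce simp: diagram_def cells_def)
qed

lemma shape_conjugate:
  assumes "is_partition lam"
  shows "shape (first_part lam) (\<lambda>j. int j - int (conjugate_part lam j))"
proof -
  have "conjugate_part lam (j + 1) \<le> conjugate_part lam j" for j
    unfolding conjugate_part_def
    by (rule card_mono) (auto intro: finite_subset [of _ "{..length lam}"])
  then have "int j - int (conjugate_part lam j) < int (j + 1) - int (conjugate_part lam (j + 1))" for j
    by (smt (verit) of_nat_1 of_nat_add of_nat_le_iff)
  then show ?thesis
    by (auto simp: shape_def next_content_def)
qed

theorem theorem1p1: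
  fixes a :: "int \<Rightarrow> int" and lam :: "nat list" and k :: "nat \<times> nat \<Rightarrow> int"
  assumes "\<And>i. a i \<ge> 2"
    and "is_partition lam"
    and "\<And>i j. (i, j) \<in> diagram lam \<Longrightarrow> k (i, j) = a (int j - int i)"
  shows "tableau_zeta lam k =
    Determinant.det (Matrix.mat (first_part lam) (first_part lam)
      (\<lambda>(i, j). jt_entry lam a (i + 1) (j + 1)))"
proof -
  define n where "n = first_part lam"
  define p where "p j = int j - int (conjugate_part lam j)" for j
  let ?x = "\<lambda>n s. [:1 / real n powi a s:]" and ?t = "[:0, 1:] :: real poly"
  let ?det = "Determinant.det (Matrix.mat n n (\<lambda>(i, j). jt_entry lam a (i + 1) (j + 1)))"
  have D: "diagram lam = cells n p" and shape: "shape n p"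
    using diagram_eq_cells [OF assms(2)] shape_conjugate [OF assms(2)]
    by (simp_all add: n_def p_def [abs_def])
  have "coeffwise_LIMSEQ (\<lambda>N. chain_sum ?x ?t N (p i) (int j)) (jt_entry lam a i j)" for i j
  proof -
    \<comment> \<open>The number of arguments is \<open>j - p i\<close>, so the default entries 0
      and 1 match the chain sums with \<open>j < p i\<close> and \<open>j = p i\<close>.\<close>
    have "jt_entry lam a i j = (if int j < p i then 0 else if p i = int j then 1
        else interp_mzv (map (\<lambda>s. a (int j - s)) [1..int j - p i]))"
      by (simp add: jt_entry_def p_def Let_def algebra_simps)
    then show ?thesis
      using chain_sum_tendsto [OF assms(1), of "p i" "int j"]
      by (auto simp: coeffwise_LIMSEQ_const)
  qed
  then have "coeffwise_LIMSEQ (\<lambda>N. chain_det ?x ?t N n p) ?det"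
    unfolding chain_det_def by (intro coeffwise_LIMSEQ_det)
  \<comment> \<open>The identity from \<open>N = 1\<close> on is enough for the limits to
    agree.\<close>
  moreover have "tableau_zeta_trunc N lam k = chain_det ?x ?t N n p" if "0 < N" for N
    using tableau_zeta_trunc_eq [of lam k a N] assms(3) that shape
    by (simp add: D finite_cells tableau_sum_eq_chain_det)
  then have "\<forall>\<^sub>F N in sequentially.
      coeff (chain_det ?x ?t N n p) d = coeff (tableau_zeta_trunc N lam k) d" for d
    by (intro eventually_sequentiallyI [of 1]) auto
  ultimately have "coeffwise_LIMSEQ (\<lambda>N. tableau_zeta_trunc N lam k) ?det"
    unfolding coeffwise_LIMSEQ_def
    by (blast intro: Lim_transform_eventually)
  then show ?thesis
    unfolding tableau_zeta_def n_def
    by (intro the_equality) (auto intro: coeffwise_LIMSEQ_unique)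
qed

end
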